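(* Let $a\in\mathbb{R}$, $b>0$, $h>2$ and $x_0\in[a,\infty)$ be real numbers. Let $A=\{z=x+iy\in\mathbb{C}: (x-a)^2+y^2<b^2\}$, $B=\{z=x+iy\in\mathbb{C}: x\ge a,\ -b\le y\le b\}$, $D=A\cup B$ and $H=\{z\in\mathbb{C}:|z|<h\}$. Let $f$ be a complex-variable function analytic at all points of $D$. Suppose there exists a function $v$ analytic at all points of $H$ which coincides for real positive values of the variable with $f\left(\frac1x+x_0-1\right)$, i.e. $v(x)=f\left(\frac1x+x_0-1\right)$ for all real $x\in(0,h)$ with $\frac1x+x_0-1\in D$. Let $c_n$ ($n\ge 0$) be the coefficients of the Taylor expansion $\sum_{n\ge0}c_n(x-x_0)^n$ of $f$ at $x_0$. Then the limits $$q'_0=\lim_{m\to\infty}\sum_{n=0}^{m}\binom{m}{n}c_n,\qquad q'_1=\lim_{m\to\infty}\sum_{n=1}^{m}\left\{\binom{m}{n+1}-m\binom{m}{n}\right\}c_n$$ exist and are finite, and $$f(x)=q'_0+q'_1\cdot\frac1x+O\left(\frac1{x^2}\right),\qquad x\to\infty,$$ where $x$ tends to $+\infty$ through real values.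
   Context: A function is analytic at all points of a (not necessarily open) set if it is analytic in a neighbourhood of each of its points. $\binom{m}{n}=0$ for $n>m$. *)

theory Defs
  imports
    "HOL-Complex_Analysis.Complex_Analysis"
    "HOL-Library.Landau_Symbols"
begin

definition end_disc :: "real \<Rightarrow> real \<Rightarrow> complex set" where
  "end_disc a b = {z. (Re z - a)\<^sup>2 + (Im z)\<^sup>2 < b\<^sup>2}"

definition half_strip :: "real \<Rightarrow> real \<Rightarrow> complex set" where
  "half_strip a b = {z. a \<le> Re z \<and> - b \<le> Im z \<and> Im z \<le> b}"

(* Not open. The library predicate analytic_on asks for holomorphy in a ball around
   every point of the set, so it applies to this set as intended. *)
definition rounded_strip :: "real \<Rightarrow> real \<Rightarrow> complex set" where
  "rounded_strip a b = end_disc a b \<union> half_strip a b"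

end

theory Submission
  imports Defs "HOL-Real_Asymp.Real_Asymp"
begin

text \<open>
  Substituting \<open>z = x0 + u / (1 - u)\<close> turns \<open>f\<close> into \<open>w u = v (1 - u)\<close>, which is holomorphic
  on the disc of radius \<open>h - 1 > 1\<close> about 0; the point \<open>z = \<infinity>\<close> corresponds to \<open>u = 1\<close>, inside
  this disc. If \<open>e\<^sub>k\<close> are the Taylor coefficients of \<open>w\<close> at 0, the two sums in the theorem are
  exactly \<open>\<Sum>k\<le>m. e\<^sub>k\<close> and \<open>- (\<Sum>k\<le>m. k * e\<^sub>k)\<close>, because \<open>(u / (1 - u))\<^sup>n / (1 - u)\<close> generates
  the binomial coefficients \<open>m choose n\<close>. Hence they converge to \<open>w 1 = v 0\<close> and
  \<open>- deriv w 1 = deriv v 0\<close>, the first two Taylor coefficients of \<open>v\<close> at 0, and these govern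
  \<open>f x = v (1 / (x - x0 + 1))\<close> as \<open>x \<rightarrow> \<infinity>\<close>.
\<close>

section \<open>Binomial sums as partial sums of a composed formal power series\<close>

definition fps_euler_map :: "complex fps" where
  "fps_euler_map = fps_X * inverse (1 - fps_X)"

lemma fps_euler_map_nth_0 [simp]: "fps_nth fps_euler_map 0 = 0"
  by (simp add: fps_euler_map_def)

text \<open>Pascal's rule, stated for the generating functions of adjacent columns of Pascal's
  triangle.\<close>

lemma one_minus_X_mult_binomial_column:
  "(1 - fps_X) * Abs_fps (\<lambda>m. of_nat (m choose Suc n) :: complex) =
     fps_X * Abs_fps (\<lambda>m. of_nat (m choose n))"
proof (rule fps_ext)
  fix m
  show "fps_nth ((1 - fps_X) * Abs_fps (\<lambda>m. of_nat (m choose Suc n) :: complex)) m =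
     fps_nth (fps_X * Abs_fps (\<lambda>m. of_nat (m choose n))) m"
    by (cases m) (simp_all add: algebra_simps)
qed

lemma fps_euler_map_power_mult_geometric:
  "fps_euler_map ^ n * inverse (1 - fps_X) = Abs_fps (\<lambda>m. of_nat (m choose n))"
proof (induction n)
  case 0
  show ?case
    by (simp add: fps_inverse_one_minus_fps_X)
next
  case (Suc n)
  have inv: "inverse (1 - fps_X) * (1 - fps_X) = (1 :: complex fps)"
    by (rule inverse_mult_eq_1) simp
  have "fps_euler_map ^ Suc n * inverse (1 - fps_X) =
      inverse (1 - fps_X) * (fps_X * (fps_euler_map ^ n * inverse (1 - fps_X)))"
    by (simp add: fps_euler_map_def mult_ac)
  also have "\<dots> = inverse (1 - fps_X) * (1 - fps_X) * Abs_fps (\<lambda>m. of_nat (m choose Suc n))"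
    unfolding Suc one_minus_X_mult_binomial_column[symmetric] by (simp add: mult.assoc)
  also have "\<dots> = Abs_fps (\<lambda>m. of_nat (m choose Suc n))"
    by (simp add: inv)
  finally show ?case .
qed

text \<open>Multiplication by \<open>inverse (1 - fps_X)\<close> turns coefficients into partial
  sums.\<close>

lemma sum_fps_euler_map_power_nth:
  "(\<Sum>k\<le>m. fps_nth (fps_euler_map ^ n) k) = of_nat (m choose n)"
proof -
  have "(\<Sum>k\<le>m. fps_nth (fps_euler_map ^ n) k) =
      fps_nth (fps_euler_map ^ n * inverse (1 - fps_X)) m"
    by (simp add: fps_inverse_one_minus_fps_X fps_mult_nth atLeast0AtMost)
  then show ?thesis
    by (simp add: fps_euler_map_power_mult_geometric)
qed

text \<open>Since \<open>fps_euler_map ^ i\<close> has no terms below order \<open>i\<close>, all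
  inner sums of the composition can be extended to the common range \<open>0..m\<close> and then
  swapped with the outer one.\<close>

lemma sum_fps_compose_euler_map_nth:
  "(\<Sum>k\<le>m. fps_nth (F oo fps_euler_map) k) = (\<Sum>n=0..m. of_nat (m choose n) * fps_nth F n)"
proof -
  have vanish: "fps_nth (fps_euler_map ^ i) k = 0" if "k < i" for i k
    using that by (intro startsby_zero_power_prefix[rule_format]) auto
  have "(\<Sum>k\<le>m. fps_nth (F oo fps_euler_map) k) =
      (\<Sum>k\<le>m. \<Sum>i=0..m. fps_nth F i * fps_nth (fps_euler_map ^ i) k)"
    unfolding fps_compose_nth
    by (intro sum.cong refl sum.mono_neutral_left) (auto simp: vanish)
  also have "\<dots> = (\<Sum>i=0..m. fps_nth F i * (\<Sum>k\<le>m. fps_nth (fps_euler_map ^ i) k))"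
    by (subst sum.swap) (simp add: sum_distrib_left)
  finally show ?thesis
    by (simp add: sum_fps_euler_map_power_nth mult_ac)
qed

text \<open>With \<open>S\<close> the partial sums of the composed series, the hockey-stick identity
  turns the left side into \<open>(\<Sum>j<m. S j) - m * S m\<close>; summation by parts gives the
  right side.\<close>

lemma sum_fps_compose_euler_map_weighted:
  "(\<Sum>n=1..m. (of_nat (m choose (n + 1)) - of_nat m * of_nat (m choose n)) * fps_nth F n) =
     - (\<Sum>k\<le>m. of_nat k * fps_nth (F oo fps_euler_map) k)"
proof -
  define S where "S = (\<lambda>m. \<Sum>k\<le>m. fps_nth (F oo fps_euler_map) k)"
  have S_eq: "S j = (\<Sum>n=0..m. of_nat (j choose n) * fps_nth F n)" if "j \<le> m" for j m
    unfolding S_def sum_fps_compose_euler_map_nth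
    using that by (intro sum.mono_neutral_left) (auto simp: binomial_eq_0)
  have hockey: "(\<Sum>n=0..m. of_nat (m choose (n + 1)) * fps_nth F n) = (\<Sum>j<m. S j)"
  proof -
    have choose: "of_nat (m choose (n + 1)) = (\<Sum>j<m. of_nat (j choose n) :: complex)" for n
      using sum_choose_upper[of n "m - 1"]
      by (cases m) (simp_all flip: of_nat_sum add: lessThan_Suc_atMost)
    have "(\<Sum>j<m. S j) = (\<Sum>j<m. \<Sum>n=0..m. of_nat (j choose n) * fps_nth F n)"
      by (intro sum.cong S_eq) auto
    also have "\<dots> = (\<Sum>n=0..m. (\<Sum>j<m. of_nat (j choose n)) * fps_nth F n)"
      by (subst sum.swap) (simp add: sum_distrib_right)
    finally show ?thesis
      by (simp only: choose)
  qed
  have "(\<Sum>n=1..m. (of_nat (m choose (n + 1)) - of_nat m * of_nat (m choose n)) * fps_nth F n) =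
      (\<Sum>n=0..m. (of_nat (m choose (n + 1)) - of_nat m * of_nat (m choose n)) * fps_nth F n)"
    \<comment> \<open>the term at 0 vanishes because its bracket is \<open>m - m\<close>\<close>
    by (intro sum.mono_neutral_left) (auto simp: not_less_eq_eq)
  also have "\<dots> = (\<Sum>n=0..m. of_nat (m choose (n + 1)) * fps_nth F n) -
      of_nat m * (\<Sum>n=0..m. of_nat (m choose n) * fps_nth F n)"
    by (simp add: algebra_simps sum_subtractf sum_distrib_left)
  also have "\<dots> = (\<Sum>j<m. S j) - of_nat m * S m"
    by (simp only: hockey S_eq[OF order.refl])
  also have "\<dots> = - (\<Sum>k\<le>m. of_nat k * fps_nth (F oo fps_euler_map) k)"
    by (induction m) (simp_all add: S_def algebra_simps)
  finally show ?thesis .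
qed

section \<open>Expansions at 0 and their uniqueness along the positive reals\<close>

lemma has_fps_expansion_euler_map:
  "(\<lambda>u. u / (1 - u)) has_fps_expansion fps_euler_map"
proof -
  have "(\<lambda>u::complex. u * inverse (1 - u)) has_fps_expansion fps_euler_map"
    unfolding fps_euler_map_def by (intro fps_expansion_intros) simp_all
  then show ?thesis
    by (simp add: divide_inverse)
qed

text \<open>Zeros of a nonzero analytic germ are isolated, so agreement at small positive reals
  suffices; the hypothesis on \<open>v\<close> provides agreement with \<open>f\<close> only at real
  points.\<close>

lemma has_fps_expansion_unique_right_real:
  fixes f g :: "complex \<Rightarrow> complex"
  assumes F: "f has_fps_expansion F" and G: "g has_fps_expansion G"
    and ev: "eventually (\<lambda>t::real. f (of_real t) = g (of_real t)) (at_right 0)"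
  shows "F = G"
proof (rule ccontr)
  assume "F \<noteq> G"
  have "(\<lambda>z. f z - g z) has_fps_expansion F - G"
    by (intro fps_expansion_intros F G)
  then have "(\<lambda>z. f (0 + z) - g (0 + z)) has_laurent_expansion fps_to_fls (F - G)"
    using has_fps_expansion_to_laurent by auto
  then have "eventually (\<lambda>z. f z - g z \<noteq> 0) (at 0)"
    using has_laurent_expansion_eventually_nonzero_iff[of "\<lambda>z. f z - g z" 0] \<open>F \<noteq> G\<close> by auto
  moreover have "filterlim complex_of_real (at 0) (at_right 0)"
    by (auto simp: filterlim_at eventually_at_filter intro!: tendsto_eq_intros)
  ultimately have "eventually (\<lambda>t::real. f (of_real t) - g (of_real t) \<noteq> 0) (at_right 0)"
    by (rule eventually_compose_filterlim)
  with ev have "eventually (\<lambda>t::real. False) (at_right 0)"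
    by eventually_elim simp
  then show False
    by simp
qed

section \<open>Second-order asymptotics, at 0 and at infinity\<close>

lemma analytic_second_order_bigo:
  assumes "v analytic_on {0}"
  shows "(\<lambda>z. v z - v 0 - deriv v 0 * z) \<in> O[at 0](\<lambda>z. z ^ 2)"
proof -
  define V where "V = fps_expansion v 0 - fps_const (v 0) - fps_const (deriv v 0) * fps_X"
  define r where "r = (\<lambda>z. v z - v 0 - deriv v 0 * z)"
  have r: "r has_fps_expansion V"
    unfolding r_def V_def
    by (intro fps_expansion_intros analytic_at_imp_has_fps_expansion_0 assms)
  have r0: "fps_nth V k = 0" if "k < 2" for k
    using that by (auto simp: V_def fps_expansion_def less_2_cases_iff)
  \<comment> \<open>The value at 0 fills the removable singularity, so continuity of
    \<open>g\<close> bounds the quotient near 0.\<close>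
  define g where "g = (\<lambda>z. if z = 0 then fps_nth V 2 else r z / z ^ 2)"
  \<comment> \<open>The zero series is separate because its \<open>subdegree\<close> is 0 by
    convention.\<close>
  have "V = 0 \<or> 2 \<le> subdegree V"
    using r0 by (auto intro: subdegree_geI)
  then have "isCont g 0 \<or> V = 0"
    using has_fps_expansion_imp_continuous[OF has_fps_expansion_shift[OF r _ refl, of 2]]
    by (auto simp: g_def)
  then have "r \<in> O[at 0](\<lambda>z. z ^ 2)"
  proof
    assume "isCont g 0"
    then have "(g \<longlongrightarrow> g 0) (at 0)"
      by (simp add: isCont_def)
    moreover have "eventually (\<lambda>z. g z = r z / z ^ 2) (at 0)"
      by (auto simp: eventually_at_filter g_def)
    ultimately have "((\<lambda>z. r z / z ^ 2) \<longlongrightarrow> g 0) (at 0)"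
      using tendsto_cong by force
    then show ?thesis
      by (rule bigoI_tendsto) (auto simp: eventually_at_filter)
  next
    assume "V = 0"
    with r have "eventually (\<lambda>z. r z = 0) (nhds 0)"
      by (simp add: has_fps_expansion_0_iff)
    then have "eventually (\<lambda>z. r z = 0) (at 0)"
      by (auto simp: eventually_at_filter elim: eventually_mono)
    then show ?thesis
      using landau_o.big.in_cong by fastforce
  qed
  then show ?thesis
    by (simp add: r_def)
qed

text \<open>Put \<open>1 / (x - s)\<close> into the estimate at 0; replacing it by
  \<open>1 / x\<close> in the linear term costs only \<open>s / (x * (x - s))\<close>, again of
  order \<open>1 / x^2\<close>.\<close>

lemma inverse_shift_bigo:
  fixes v :: "complex \<Rightarrow> complex" and s :: real
  assumes "v analytic_on {0}"
  shows "(\<lambda>x::real. v (of_real (1 / (x - s))) - (v 0 + deriv v 0 * (1 / of_real x)))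
    \<in> O[at_top](\<lambda>x. 1 / (of_real x)\<^sup>2)"
proof -
  have lim: "filterlim (\<lambda>x. complex_of_real (1 / (x - s))) (at 0) at_top"
  proof -
    have "((\<lambda>x. 1 / (x - s)) \<longlongrightarrow> 0) at_top"
      by real_asymp
    then have "((\<lambda>x. complex_of_real (1 / (x - s))) \<longlongrightarrow> 0) at_top"
      using tendsto_of_real[of _ 0, where 'a = complex] by (simp only: of_real_0)
    moreover have "eventually (\<lambda>x. complex_of_real (1 / (x - s)) \<noteq> 0) at_top"
      using eventually_gt_at_top[of s] by eventually_elim auto
    ultimately show ?thesis
      by (simp add: filterlim_at)
  qed
  have "(\<lambda>x. v (of_real (1 / (x - s))) - v 0 - deriv v 0 * of_real (1 / (x - s)))
      \<in> O[at_top](\<lambda>x. (complex_of_real (1 / (x - s))) ^ 2)"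
    by (rule landau_o.big.compose[OF analytic_second_order_bigo[OF assms] lim])
  also have "(\<lambda>x. (complex_of_real (1 / (x - s))) ^ 2) \<in> O[at_top](\<lambda>x. 1 / (complex_of_real x)\<^sup>2)"
  proof -
    have "(\<lambda>x. (1 / (x - s)) ^ 2) \<in> O[at_top](\<lambda>x::real. 1 / x\<^sup>2)"
      by real_asymp
    then have "(\<lambda>x. complex_of_real ((1 / (x - s)) ^ 2)) \<in> O[at_top](\<lambda>x::real. complex_of_real (1 / x\<^sup>2))"
      by (simp only: landau_o.big.of_real_iff)
    then show ?thesis
      by simp
  qed
  finally have 1: "(\<lambda>x. v (of_real (1 / (x - s))) - v 0 - deriv v 0 * of_real (1 / (x - s)))
      \<in> O[at_top](\<lambda>x. 1 / (complex_of_real x)\<^sup>2)" .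
  have 2: "(\<lambda>x. deriv v 0 * complex_of_real (1 / (x - s) - 1 / x)) \<in> O[at_top](\<lambda>x. 1 / (complex_of_real x)\<^sup>2)"
  proof -
    have "(\<lambda>x. 1 / (x - s) - 1 / x) \<in> O[at_top](\<lambda>x::real. 1 / x\<^sup>2)"
      by real_asymp
    then have "(\<lambda>x. complex_of_real (1 / (x - s) - 1 / x)) \<in> O[at_top](\<lambda>x::real. complex_of_real (1 / x\<^sup>2))"
      by (simp only: landau_o.big.of_real_iff)
    then show ?thesis
      by (auto simp: landau_o.big.cmult_in_iff)
  qed
  show ?thesis
    using sum_in_bigo(1)[OF 1 2] by (simp add: algebra_simps)
qed

theorem theorem1:
  fixes a b h x0 :: real
    and f :: "complex \<Rightarrow> complex"
    and c :: "nat \<Rightarrow> complex"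
  assumes "b > 0"
    and "h > 2"
    and "x0 \<in> {a..}"
    and "f analytic_on rounded_strip a b"
    and "\<exists>v. v analytic_on {z. cmod z < h} \<and>
           (\<forall>x::real. x \<in> {0<..<h} \<longrightarrow> complex_of_real (1 / x + x0 - 1) \<in> rounded_strip a b \<longrightarrow>
              v (complex_of_real x) = f (complex_of_real (1 / x + x0 - 1)))"
    and "\<And>n. c n = fps_nth (fps_expansion f (complex_of_real x0)) n"
  shows "\<exists>q0 q1 :: complex.
           (\<lambda>m. \<Sum>n=0..m. of_nat (m choose n) * c n) \<longlonglongrightarrow> q0 \<and>
           (\<lambda>m. \<Sum>n=1..m. (of_nat (m choose (n + 1)) - of_nat m * of_nat (m choose n)) * c n)
             \<longlonglongrightarrow> q1 \<and>
           (\<lambda>x::real. f (complex_of_real x) - (q0 + q1 * (1 / complex_of_real x)))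
             \<in> O[at_top](\<lambda>x. 1 / (complex_of_real x)\<^sup>2)"
proof -
  obtain v where v: "v analytic_on {z. cmod z < h}"
    and v_eq: "\<And>x::real. x \<in> {0<..<h} \<Longrightarrow> of_real (1 / x + x0 - 1) \<in> rounded_strip a b \<Longrightarrow>
              v (of_real x) = f (of_real (1 / x + x0 - 1))"
    using assms(5) by blast
  have strip: "complex_of_real x \<in> rounded_strip a b" if "x \<ge> a" for x
    using that \<open>b > 0\<close> by (simp add: rounded_strip_def half_strip_def)
  \<comment> \<open>The real ray from \<open>x0\<close> to infinity lies in the strip and
    corresponds to arguments of \<open>v\<close> in the interval from 0 (excluded) to 1.\<close>
  have v_inverse: "v (of_real (1 / (1 + y))) = f (of_real (x0 + y))" if "y \<ge> 0" for y
  proof -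
    have "1 / (1 + y) \<le> 1"
      using that by simp
    then have "1 / (1 + y) < h"
      using \<open>h > 2\<close> by linarith
    then have "1 / (1 + y) \<in> {0<..<h}"
      using that by simp
    moreover have "1 / (1 / (1 + y)) + x0 - 1 = x0 + y"
      by simp
    ultimately show ?thesis
      using v_eq[of "1 / (1 + y)"] strip[of "x0 + y"] that \<open>x0 \<in> {a..}\<close> by (auto simp: add.commute)
  qed

  define F where "F = fps_expansion f (of_real x0)"
  define E where "E = F oo fps_euler_map"
  define w where "w = (\<lambda>u. v (1 - u))"
  have "(\<lambda>u. f (of_real x0 + u)) has_fps_expansion F"
    unfolding F_def using assms(4) strip[of x0] \<open>x0 \<in> {a..}\<close>
    by (intro analytic_at_imp_has_fps_expansion) (auto elim: analytic_on_subset)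
  from has_fps_expansion_compose[OF this has_fps_expansion_euler_map]
  have f_E: "(\<lambda>u. f (of_real x0 + u / (1 - u))) has_fps_expansion E"
    by (simp add: o_def E_def)

  have v_hol: "v holomorphic_on ball 0 h"
    using v by (auto simp: ball_def dist_norm norm_minus_commute intro!: analytic_imp_holomorphic
        elim: back_subst[of "(analytic_on) v"])
  \<comment> \<open>As \<open>h > 2\<close>, the radius \<open>h - 1\<close> exceeds 1, so both
    \<open>w\<close> and its derivative may later be expanded at \<open>u = 1\<close>.\<close>
  have ball_shift: "1 - u \<in> ball 0 h" if "norm u < h - 1" for u :: complex
    using norm_triangle_ineq4[of 1 u] that by simp
  have w_hol: "w holomorphic_on ball 0 (h - 1)"
    unfolding w_def
    by (rule holomorphic_on_compose_gen[OF _ v_hol, of "\<lambda>u. 1 - u", unfolded o_def])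
      (use ball_shift in \<open>auto intro!: holomorphic_intros\<close>)
  have w_exp: "w has_fps_expansion fps_expansion w 0"
    using w_hol \<open>h > 2\<close> by (intro has_fps_expansion_fps_expansion[of "ball 0 (h - 1)"]) auto
  have agree: "eventually (\<lambda>t::real. f (of_real x0 + of_real t / (1 - of_real t)) = w (of_real t)) (at_right 0)"
  proof -
    have "eventually (\<lambda>t::real. 0 < t \<and> t < 1) (at_right 0)"
      using eventually_at_right_real[of 0 1] by simp
    then show ?thesis
    proof eventually_elim
      case (elim t)
      then have "1 / (1 + t / (1 - t)) = 1 - t" "t / (1 - t) \<ge> 0"
        by (auto simp: field_simps)
      then show ?case
        using v_inverse[of "t / (1 - t)"] by (simp add: w_def)
    qed
  qed
  \<comment> \<open>The expansion of \<open>f\<close> after the substitution is only known near 0;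
    identifying it with that of \<open>w\<close> makes \<open>E\<close> converge on the whole disc
    of radius \<open>h - 1\<close>.\<close>
  have w_E: "w has_fps_expansion E"
    using has_fps_expansion_unique_right_real[OF f_E w_exp agree] w_exp by simp

  have w_1: "w 1 = v 0"
    by (simp add: w_def)
  have w'_1: "deriv w 1 = - deriv v 0"
  proof -
    have "(v has_field_derivative deriv v 0) (at (1 - 1))"
      using v_hol \<open>h > 2\<close> by (auto intro!: holomorphic_derivI[of _ "ball 0 h"])
    then have "(w has_field_derivative deriv v 0 * (- 1)) (at 1)"
      unfolding w_def
      by (rule DERIV_chain2) (auto intro!: derivative_eq_intros)
    then show ?thesis
      by (simp add: DERIV_imp_deriv)
  qed
  have w_hol_eball: "w holomorphic_on eball 0 (ereal (h - 1))"
    using w_hol by simp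
  have "(\<lambda>k. fps_nth E k * 1 ^ k) sums w 1"
    using w_E w_hol_eball by (rule has_fps_expansion_imp_sums_complex) (use \<open>h > 2\<close> in auto)
  then have sums_E: "(\<lambda>m. \<Sum>k\<le>m. fps_nth E k) \<longlonglongrightarrow> v 0"
    by (simp add: sums_def_le w_1)
  have "(\<lambda>k. fps_nth (fps_deriv E) k * 1 ^ k) sums deriv w 1"
    by (rule has_fps_expansion_imp_sums_complex[OF has_fps_expansion_deriv[OF w_E]
          holomorphic_deriv[OF w_hol_eball]])
      (use \<open>h > 2\<close> in auto)
  then have "(\<lambda>k. of_nat (Suc k) * fps_nth E (Suc k)) sums (- deriv v 0)"
    by (simp add: w'_1)
  \<comment> \<open>The index shift is free: the term at \<open>k = 0\<close> vanishes.\<close>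
  then have "(\<lambda>k. of_nat k * fps_nth E k) sums (- deriv v 0)"
    by (subst (asm) sums_Suc_iff) simp
  then have "(\<lambda>m. \<Sum>k\<le>m. of_nat k * fps_nth E k) \<longlonglongrightarrow> - deriv v 0"
    by (simp add: sums_def_le)
  from tendsto_minus[OF this]
  have sums_E': "(\<lambda>m. - (\<Sum>k\<le>m. of_nat k * fps_nth E k)) \<longlonglongrightarrow> deriv v 0"
    by simp

  have "v analytic_on {0}"
    using v \<open>h > 2\<close> by (auto elim: analytic_on_subset)
  \<comment> \<open>Solving \<open>x = 1 / t + x0 - 1\<close> for \<open>t\<close> gives
    \<open>t = 1 / (x - (x0 - 1))\<close>.\<close>
  from inverse_shift_bigo[OF this, of "x0 - 1"]
  have "(\<lambda>x::real. f (of_real x) - (v 0 + deriv v 0 * (1 / of_real x)))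
      \<in> O[at_top](\<lambda>x. 1 / (of_real x)\<^sup>2)"
  proof (rule landau_o.big.in_cong[THEN iffD1, rotated])
    show "eventually (\<lambda>x::real. v (of_real (1 / (x - (x0 - 1)))) - (v 0 + deriv v 0 * (1 / of_real x)) =
        f (of_real x) - (v 0 + deriv v 0 * (1 / of_real x))) at_top"
      using eventually_ge_at_top[of x0]
    proof eventually_elim
      case (elim x)
      then show ?case
        using v_inverse[of "x - x0"] by (simp add: algebra_simps)
    qed
  qed
  then show ?thesis
    using sums_E sums_E'
    unfolding assms(6) F_def[symmetric] E_def sum_fps_compose_euler_map_nth
      sum_fps_compose_euler_map_weighted
    by blast
qed

end
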